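(* Let $X$ be a full right Hilbert $C^*$-module over a $C^*$-algebra $A$, let $p\in A$ be a projection, let $x_0\in S_p(X)$, and let $[x_0]=\{x_0a: a\in A\}\in\mathcal P(X)$. Then the connected component $\mathcal P(X)_{[x_0]}$ of $[x_0]$ in $\mathcal P(X)$ is homeomorphic to the connected component of $\theta_{x_0,x_0}$ in the space $\mathcal E_{x_0}$ of projections of $\mathcal L_A(X)$ that are Murray-von Neumann equivalent to $\theta_{x_0,x_0}$ (with the norm topology).
   Context: $X$ full means that the span of $\{\langle x,y\rangle : x,y\in X\}$ is dense in $A$. $\mathcal L_A(X)$ is the $C^*$-algebra of adjointable operators on $X$; for $x,y\in X$, $\theta_{x,y}\in\mathcal L_A(X)$ is $\theta_{x,y}(z)=x\langle y,z\rangle$. Projection means self-adjoint idempotent. For a projection $p\in A$, $S_p(X)=\{x\in X:\langle x,x\rangle=p\}$ (norm topology). If $x\in S_p(X)$ then $x=xp$ and $\theta_{x,x}$ is a projection. The projective space $\mathcal P(X)$ is the set of submodules of $X$ of the form $[x]=\{xa:a\in A\}$ that are orthocomplemented in $X$; each such submodule equals $[x]$ for some $x\in S_p(X)$ and some projection $p\in A$. $\mathcal P(X)$ carries the quotient topology given by the maps $\rho:S_p(X)\to\mathcal P(X)$, $\rho(x)=[x]$, for all projections $p\in A$. *)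

theory Defs
  imports "HOL-Analysis.Analysis"
begin

section \<open>Complex Banach spaces and C*-algebras\<close>

class complex_banach = banach +
  fixes scaleC :: "complex \<Rightarrow> 'a \<Rightarrow> 'a"  (infixr "*\<^sub>C" 75)
  assumes scaleC_add_right: "c *\<^sub>C (x + y) = c *\<^sub>C x + c *\<^sub>C y"
    and scaleC_add_left: "(c + d) *\<^sub>C x = c *\<^sub>C x + d *\<^sub>C x"
    and scaleC_scaleC: "c *\<^sub>C d *\<^sub>C x = (c * d) *\<^sub>C x"
    and scaleC_of_real: "complex_of_real r *\<^sub>C x = r *\<^sub>R x"
    and norm_scaleC: "norm (c *\<^sub>C x) = cmod c * norm x"

text \<open>C*-algebras are not assumed to be unital.\<close>

class cstar_algebra = complex_banach + real_normed_algebra +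
  fixes star :: "'a \<Rightarrow> 'a"
  assumes scaleC_mult_left: "(c *\<^sub>C x) * y = c *\<^sub>C (x * y)"
    and scaleC_mult_right: "x * (c *\<^sub>C y) = c *\<^sub>C (x * y)"
    and star_star: "star (star x) = x"
    and star_add: "star (x + y) = star x + star y"
    and star_scaleC: "star (c *\<^sub>C x) = cnj c *\<^sub>C star x"
    and star_mult: "star (x * y) = star y * star x"
    and cstar_identity: "norm (star x * x) = (norm x)\<^sup>2"

text \<open>
  Positivity via \<open>b\<^sup>*b\<close>: no spectrum (hence no unitisation) is needed to state it.
\<close>

definition positive :: "'a::cstar_algebra \<Rightarrow> bool"
  where "positive a \<longleftrightarrow> (\<exists>b. a = star b * b)"

definition projection :: "'a::cstar_algebra \<Rightarrow> bool"
  where "projection p \<longleftrightarrow> star p = p \<and> p * p = p"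

section \<open>Hilbert C*-modules\<close>

text \<open>
  The inner product is conjugate-linear in the first variable. Completeness is part of the class
  \<^class>\<open>complex_banach\<close>; the assumption \<open>norm_ip\<close> says that the norm of the
  underlying Banach space is the one induced by the inner product.
\<close>

locale hilbert_module =
  fixes act :: "'x::complex_banach \<Rightarrow> 'a::cstar_algebra \<Rightarrow> 'x"
    and ip :: "'x \<Rightarrow> 'x \<Rightarrow> 'a"
  assumes act_add_left: "act (x + y) a = act x a + act y a"
    and act_add_right: "act x (a + b) = act x a + act x b"
    and act_act: "act (act x a) b = act x (a * b)"
    and act_scaleC_left: "act (c *\<^sub>C x) a = c *\<^sub>C act x a"
    and act_scaleC_right: "act x (c *\<^sub>C a) = c *\<^sub>C act x a"
    and ip_add_right: "ip x (y + z) = ip x y + ip x z"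
    and ip_scaleC_right: "ip x (c *\<^sub>C y) = c *\<^sub>C ip x y"
    and ip_act_right: "ip x (act y a) = ip x y * a"
    and star_ip: "star (ip x y) = ip y x"
    and ip_positive: "positive (ip x x)"
    and ip_definite: "ip x x = 0 \<Longrightarrow> x = 0"
    and norm_ip: "norm x = sqrt (norm (ip x x))"

text \<open>
  The set of all inner products is closed under complex multiples, so its real span
  is also its complex span.
\<close>

definition full :: "('x \<Rightarrow> 'x \<Rightarrow> 'a::cstar_algebra) \<Rightarrow> bool"
  where "full ip \<longleftrightarrow> closure (span {ip x y | x y. True}) = UNIV"

section \<open>Adjointable operators\<close>

text \<open>
  Operators live in the type \<^typ>\<open>'x \<Rightarrow>\<^sub>L 'x\<close> of bounded real-linear maps, whose topology is
  given by the operator norm. Nothing is lost: every map with an adjoint is complex-linear,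
  \<open>A\<close>-linear and bounded (see \<open>adjointable_bounded_linear\<close> below for boundedness).
\<close>

definition is_adjoint :: "('x \<Rightarrow> 'x \<Rightarrow> 'a) \<Rightarrow> ('x \<Rightarrow> 'x) \<Rightarrow> ('x \<Rightarrow> 'x) \<Rightarrow> bool"
  where "is_adjoint ip T S \<longleftrightarrow> (\<forall>x y. ip (T x) y = ip x (S y))"

definition adjointable_ops :: "('x::complex_banach \<Rightarrow> 'x \<Rightarrow> 'a) \<Rightarrow> ('x \<Rightarrow>\<^sub>L 'x) set"
  where "adjointable_ops ip = {T. \<exists>S. is_adjoint ip (blinfun_apply T) S}"

definition projection_op :: "('x::complex_banach \<Rightarrow> 'x \<Rightarrow> 'a) \<Rightarrow> ('x \<Rightarrow>\<^sub>L 'x) \<Rightarrow> bool"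
  where "projection_op ip P \<longleftrightarrow>
    is_adjoint ip (blinfun_apply P) (blinfun_apply P) \<and> P o\<^sub>L P = P"

text \<open>\<open>P = V\<^sup>*V\<close> and \<open>Q = VV\<^sup>*\<close>, where \<open>W\<close> plays the role of \<open>V\<^sup>*\<close>.\<close>

definition mvn_equiv ::
    "('x::complex_banach \<Rightarrow> 'x \<Rightarrow> 'a) \<Rightarrow> ('x \<Rightarrow>\<^sub>L 'x) \<Rightarrow> ('x \<Rightarrow>\<^sub>L 'x) \<Rightarrow> bool"
  where "mvn_equiv ip P Q \<longleftrightarrow>
    (\<exists>V\<in>adjointable_ops ip. \<exists>W\<in>adjointable_ops ip.
       is_adjoint ip (blinfun_apply V) (blinfun_apply W) \<and> W o\<^sub>L V = P \<and> V o\<^sub>L W = Q)"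

text \<open>The map below is bounded linear in every Hilbert module, see \<open>theta_apply\<close>.\<close>

definition theta ::
    "('x::complex_banach \<Rightarrow> 'a \<Rightarrow> 'x) \<Rightarrow> ('x \<Rightarrow> 'x \<Rightarrow> 'a) \<Rightarrow> 'x \<Rightarrow> 'x \<Rightarrow> 'x \<Rightarrow>\<^sub>L 'x"
  where "theta act ip x y = Blinfun (\<lambda>z. act x (ip y z))"

definition equivalent_projections ::
    "('x::complex_banach \<Rightarrow> 'a \<Rightarrow> 'x) \<Rightarrow> ('x \<Rightarrow> 'x \<Rightarrow> 'a) \<Rightarrow> 'x \<Rightarrow> ('x \<Rightarrow>\<^sub>L 'x) set"
  where "equivalent_projections act ip x =
    {Q \<in> adjointable_ops ip. projection_op ip Q \<and> mvn_equiv ip Q (theta act ip x x)}"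

section \<open>The projective space\<close>

definition proj_sphere :: "('x \<Rightarrow> 'x \<Rightarrow> 'a) \<Rightarrow> 'a \<Rightarrow> 'x set"
  where "proj_sphere ip p = {x. ip x x = p}"

definition ray :: "('x \<Rightarrow> 'a \<Rightarrow> 'x) \<Rightarrow> 'x \<Rightarrow> 'x set"
  where "ray act x = range (act x)"

definition ortho_compl :: "('x \<Rightarrow> 'x \<Rightarrow> 'a::zero) \<Rightarrow> 'x set \<Rightarrow> 'x set"
  where "ortho_compl ip M = {z. \<forall>m\<in>M. ip m z = 0}"

definition orthocomplemented :: "('x::plus \<Rightarrow> 'x \<Rightarrow> 'a::zero) \<Rightarrow> 'x set \<Rightarrow> bool"
  where "orthocomplemented ip M \<longleftrightarrow> (\<forall>z. \<exists>m\<in>M. \<exists>n\<in>ortho_compl ip M. z = m + n)"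

definition projective_space ::
    "('x::plus \<Rightarrow> 'a \<Rightarrow> 'x) \<Rightarrow> ('x \<Rightarrow> 'x \<Rightarrow> 'a::zero) \<Rightarrow> 'x set set"
  where "projective_space act ip = {ray act x | x. orthocomplemented ip (ray act x)}"

text \<open>
  The quotient (final) topology determined jointly by all the maps \<open>x \<mapsto> [x]\<close>
  from \<open>S\<^sub>p(X)\<close>, with its norm topology, where \<open>p\<close> ranges over all projections of \<open>A\<close>.
\<close>

definition projective_topology ::
    "('x::complex_banach \<Rightarrow> 'a::cstar_algebra \<Rightarrow> 'x) \<Rightarrow> ('x \<Rightarrow> 'x \<Rightarrow> 'a) \<Rightarrow> 'x set topology"
  where "projective_topology act ip = topology (\<lambda>U.
    U \<subseteq> projective_space act ip \<and>
    (\<forall>p. projection p \<longrightarrow>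
       openin (top_of_set (proj_sphere ip p)) {x \<in> proj_sphere ip p. ray act x \<in> U}))"

section \<open>Well-definedness of the notions above\<close>

lemma openin_projective_topology:
  fixes act :: "'x::complex_banach \<Rightarrow> 'a::cstar_algebra \<Rightarrow> 'x"
  shows "openin (projective_topology act ip) U \<longleftrightarrow>
    U \<subseteq> projective_space act ip \<and>
    (\<forall>p. projection p \<longrightarrow>
       openin (top_of_set (proj_sphere ip p)) {x \<in> proj_sphere ip p. ray act x \<in> U})"
proof -
  let ?pre = "\<lambda>p U. {x \<in> proj_sphere ip p. ray act x \<in> U}"
  have "istopology (\<lambda>U. U \<subseteq> projective_space act ip \<and>
    (\<forall>p. projection p \<longrightarrow> openin (top_of_set (proj_sphere ip p)) (?pre p U)))"
    (is "istopology ?O")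
    unfolding istopology_def
  proof (intro conjI allI impI)
    fix S T assume S: "?O S" and T: "?O T"
    then show "S \<inter> T \<subseteq> projective_space act ip" by blast
    fix p :: 'a assume "projection p"
    moreover have "?pre p (S \<inter> T) = ?pre p S \<inter> ?pre p T" by blast
    ultimately show "openin (top_of_set (proj_sphere ip p)) (?pre p (S \<inter> T))"
      using S T by auto
  next
    fix K assume K: "\<forall>S\<in>K. ?O S"
    then show "\<Union>K \<subseteq> projective_space act ip" by blast
    fix p :: 'a assume p: "projection p"
    have "?pre p (\<Union>K) = (\<Union>S\<in>K. ?pre p S)" by blast
    then show "openin (top_of_set (proj_sphere ip p)) (?pre p (\<Union>K))"
      using K p by auto
  qed
  then show ?thesis
    unfolding projective_topology_def by (simp add: topology_inverse')
qed

lemma norm_star [simp]: "norm (star x) = norm (x::'a::cstar_algebra)"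
proof -
  have le: "norm y \<le> norm (star y)" for y :: 'a
  proof (cases "norm y = 0")
    case False
    have "norm y * norm y \<le> norm (star y) * norm y"
      using norm_mult_ineq[of "star y" y] by (simp add: cstar_identity power2_eq_square)
    then show ?thesis using False by simp
  qed simp
  show ?thesis using le[of x] le[of "star x"] by (simp add: star_star)
qed

context hilbert_module
begin

lemma norm_ip_self: "norm (ip x x) = (norm x)\<^sup>2"
  by (simp add: norm_ip[of x])

lemma ip_act_left: "ip (act x a) y = star a * ip x y"
  by (metis star_ip ip_act_right star_mult)

lemma ip_add_left: "ip (x + y) z = ip x z + ip y z"
  by (metis star_ip ip_add_right star_add)

lemma ip_scaleC_left: "ip (c *\<^sub>C x) y = cnj c *\<^sub>C ip x y"
  by (metis star_ip ip_scaleC_right star_scaleC)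

lemma ip_scaleR_right: "ip x (r *\<^sub>R y) = r *\<^sub>R ip x y"
  by (metis ip_scaleC_right scaleC_of_real)

lemma ip_scaleR_left: "ip (r *\<^sub>R x) y = r *\<^sub>R ip x y"
  by (metis complex_cnj_complex_of_real ip_scaleC_left scaleC_of_real)

lemma act_scaleR_right: "act x (r *\<^sub>R a) = r *\<^sub>R act x a"
  by (metis act_scaleC_right scaleC_of_real)

lemma ip_zero_right [simp]: "ip x 0 = 0"
  using ip_scaleR_right[of x 0 0] by simp

lemma ip_zero_left [simp]: "ip 0 x = 0"
  using ip_scaleR_left[of 0 0 x] by simp

lemma ip_diff_right: "ip x (y - z) = ip x y - ip x z"
  using ip_add_right[of x "y - z" z] by (simp add: algebra_simps)

lemma ip_diff_left: "ip (x - y) z = ip x z - ip y z"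
  using ip_add_left[of "x - y" y z] by (simp add: algebra_simps)

lemma ip_eqI: "(\<And>x. ip x y = ip x z) \<Longrightarrow> y = z"
  using ip_definite[of "y - z"] by (simp add: ip_diff_right)

lemma norm_act_le: "norm (act x a) \<le> norm x * norm a"
proof -
  have "(norm (act x a))\<^sup>2 = norm (star a * (ip x x * a))"
    by (simp add: norm_ip_self[symmetric] ip_act_left ip_act_right mult.assoc)
  also have "\<dots> \<le> norm a * (norm (ip x x) * norm a)"
  proof -
    have "norm (star a * (ip x x * a)) \<le> norm (star a) * norm (ip x x * a)"
      by (rule norm_mult_ineq)
    also have "\<dots> \<le> norm (star a) * (norm (ip x x) * norm a)"
      by (rule mult_left_mono[OF norm_mult_ineq norm_ge_zero])
    finally show ?thesis by simp
  qed
  also have "\<dots> = (norm x * norm a)\<^sup>2"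
    by (simp add: norm_ip_self power2_eq_square)
  finally show ?thesis
    by (simp add: abs_le_square_iff[symmetric])
qed

text \<open>A crude form of the Cauchy-Schwarz inequality, from polarisation.\<close>

lemma norm_ip_le: "norm (ip x y) \<le> 4 * (norm x * norm y)"
proof (cases "x = 0 \<or> y = 0")
  case True
  then show ?thesis by auto
next
  case False
  have unit: "norm (ip u v) \<le> 4" if u: "norm u = 1" and v: "norm v = 1" for u v
  proof -
    define q where "q c = ip (u + c *\<^sub>C v) (u + c *\<^sub>C v)" for c
    have q: "norm (q c) \<le> 4" if "cmod c = 1" for c
    proof -
      have "norm (u + c *\<^sub>C v) \<le> 2"
        using norm_triangle_ineq[of u "c *\<^sub>C v"] u v that by (simp add: norm_scaleC)
      then have "(norm (u + c *\<^sub>C v))\<^sup>2 \<le> 2\<^sup>2"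
        by (intro power_mono) auto
      then show ?thesis by (simp add: q_def norm_ip_self)
    qed
    have exp: "q c = ip u u + c *\<^sub>C ip u v + cnj c *\<^sub>C ip v u + (cnj c * c) *\<^sub>C ip v v" for c
      by (simp add: q_def ip_add_left ip_add_right ip_scaleC_left ip_scaleC_right
          scaleC_add_right scaleC_scaleC algebra_simps)
    have m1: "(-1) *\<^sub>C a = - a" for a :: 'a
      using scaleC_of_real[of "-1" a] by simp
    have p1: "1 *\<^sub>C a = a" for a :: 'a
      using scaleC_of_real[of 1 a] by simp
    have mc: "(- c) *\<^sub>C a = - (c *\<^sub>C a)" for c and a :: 'a
      using scaleC_scaleC[of "-1" c a] by (simp add: m1)
    have neg: "c *\<^sub>C (- a) = - (c *\<^sub>C a)" for c and a :: 'a
      by (metis m1 mc mult.commute scaleC_scaleC)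
    have mi: "\<i> *\<^sub>C \<i> *\<^sub>C a = - a" for a :: 'a
      by (simp add: scaleC_scaleC m1)
    have d: "q 1 - q (-1) = 2 *\<^sub>R (ip u v + ip v u)"
      by (simp add: exp p1 m1 algebra_simps scaleR_2)
    have e: "q \<i> - q (-\<i>) = 2 *\<^sub>R (\<i> *\<^sub>C ip u v - \<i> *\<^sub>C ip v u)"
      by (simp add: exp p1 mc algebra_simps scaleR_2)
    have dm: "\<i> *\<^sub>C (q \<i> - q (-\<i>)) = 2 *\<^sub>R (ip v u - ip u v)"
    proof -
      have "\<i> *\<^sub>C (a - b) = \<i> *\<^sub>C a - \<i> *\<^sub>C b" for a b :: 'a
        using scaleC_add_right[of \<i> a "- b"] by (simp add: neg)
      then show ?thesis
        unfolding e scaleR_2 by (simp add: scaleC_add_right mi)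
    qed
    have "4 *\<^sub>R ip u v = (q 1 - q (-1)) - \<i> *\<^sub>C (q \<i> - q (-\<i>))"
      unfolding d dm by (simp add: algebra_simps scaleR_2[symmetric])
    then have "4 * norm (ip u v) = norm ((q 1 - q (-1)) - \<i> *\<^sub>C (q \<i> - q (-\<i>)))"
      by (metis norm_scaleR abs_numeral)
    also have "\<dots> \<le> norm (q 1 - q (-1)) + norm (\<i> *\<^sub>C (q \<i> - q (-\<i>)))"
      by (rule norm_triangle_ineq4)
    also have "\<dots> \<le> (norm (q 1) + norm (q (-1))) + (norm (q \<i>) + norm (q (-\<i>)))"
      using norm_triangle_ineq4[of "q 1" "q (-1)"] norm_triangle_ineq4[of "q \<i>" "q (-\<i>)"]
      by (simp add: norm_scaleC)
    also have "\<dots> \<le> 4 * 4"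
      using q[of 1] q[of "-1"] q[of \<i>] q[of "-\<i>"] by simp
    finally show ?thesis by simp
  qed
  let ?u = "inverse (norm x) *\<^sub>R x" and ?v = "inverse (norm y) *\<^sub>R y"
  have "norm (ip ?u ?v) \<le> 4"
    using False by (intro unit) auto
  then have "inverse (norm x) * (inverse (norm y) * norm (ip x y)) \<le> 4"
    by (simp add: ip_scaleR_left ip_scaleR_right mult_ac)
  then show ?thesis
    using False by (simp add: field_simps)
qed

lemma bounded_linear_theta: "bounded_linear (\<lambda>z. act x (ip y z))"
proof (rule bounded_linear_intro)
  show "norm (act x (ip y z)) \<le> norm z * (4 * norm x * norm y)" for z
  proof -
    have "norm (act x (ip y z)) \<le> norm x * norm (ip y z)"
      by (rule norm_act_le)
    also have "\<dots> \<le> norm x * (4 * (norm y * norm z))"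
      by (intro mult_left_mono norm_ip_le) auto
    finally show ?thesis by (simp add: mult_ac)
  qed
qed (simp_all add: ip_add_right act_add_right ip_scaleR_right act_scaleR_right)

lemma theta_apply [simp]: "blinfun_apply (theta act ip x y) z = act x (ip y z)"
  unfolding theta_def by (simp add: bounded_linear_Blinfun_apply[OF bounded_linear_theta])

lemma theta_adjointable: "theta act ip x y \<in> adjointable_ops ip"
proof -
  have "is_adjoint ip (blinfun_apply (theta act ip x y)) (blinfun_apply (theta act ip y x))"
    unfolding is_adjoint_def by (simp add: ip_act_left ip_act_right star_ip)
  then show ?thesis unfolding adjointable_ops_def by blast
qed

lemma bounded_linear_ip_right: "bounded_linear (ip x)"
proof (rule bounded_linear_intro)
  show "norm (ip x z) \<le> norm z * (4 * norm x)" for z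
    using norm_ip_le[of x z] by (simp add: mult_ac)
qed (simp_all add: ip_add_right ip_scaleR_right)

lemma adjointable_bounded_linear:
  assumes adj: "is_adjoint ip T S"
  shows "bounded_linear T"
proof -
  have TS: "ip (T x) y = ip x (S y)" for x y
    using adj by (simp add: is_adjoint_def)
  have ST: "ip (S x) y = ip x (T y)" for x y
    by (metis TS star_ip)
  have add: "T (x + y) = T x + T y" for x y
    by (rule ip_eqI) (simp add: ST[symmetric] ip_add_right)
  have scale: "T (r *\<^sub>R x) = r *\<^sub>R T x" for r x
    by (rule ip_eqI) (simp add: ST[symmetric] ip_scaleR_right)
  define K where "K n = {x. \<forall>y. norm y \<le> 1 \<longrightarrow> norm (ip (T y) x) \<le> real n}" for n
  have closed: "closed (K n)" for n
  proof -
    have "K n = (\<Inter>y\<in>{y. norm y \<le> 1}. {x. norm (ip (T y) x) \<le> real n})"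
      by (auto simp: K_def)
    moreover have "closed {x. norm (ip (T y) x) \<le> real n}" for y
      by (intro closed_Collect_le continuous_intros
          bounded_linear.continuous_on[OF bounded_linear_ip_right])
    ultimately show ?thesis by auto
  qed
  have cover: "\<exists>n. x \<in> K n" for x
  proof -
    obtain n where n: "4 * norm (S x) \<le> real n"
      using real_arch_simple by blast
    have "norm (ip (T y) x) \<le> real n" if "norm y \<le> 1" for y
    proof -
      have "norm (ip (T y) x) \<le> 4 * (norm y * norm (S x))"
        unfolding TS by (rule norm_ip_le)
      also have "\<dots> \<le> 4 * (1 * norm (S x))"
        by (intro mult_left_mono mult_right_mono that) auto
      finally show ?thesis using n by simp
    qed
    then show ?thesis by (auto simp: K_def)
  qed
  have "\<exists>n. interior (K n) \<noteq> {}"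
  proof (rule ccontr)
    assume "\<not> ?thesis"
    then have emp: "interior (K n) = {}" for n by simp
    have "euclidean closure_of \<Inter>(range (\<lambda>n. - K n)) = topspace (euclidean :: 'x topology)"
    proof (rule Baire_category)
      show "completely_metrizable_space (euclidean :: 'x topology) \<or>
          locally_compact_space (euclidean :: 'x topology) \<and> regular_space (euclidean :: 'x topology)"
        by (simp add: completely_metrizable_space_euclidean)
      fix U assume "U \<in> range (\<lambda>n. - K n)"
      then obtain n where U: "U = - K n" by blast
      show "openin euclidean U \<and> euclidean closure_of U = topspace euclidean"
        using closed[of n] emp[of n] by (simp add: U closure_complement open_Compl)
    qed auto
    moreover have "\<Inter>(range (\<lambda>n. - K n)) = {}" using cover by auto
    ultimately show False by simp
  qed
  then obtain n x0 where "x0 \<in> interior (K n)" by blast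
  then obtain e where e: "e > 0" "cball x0 e \<subseteq> K n"
    by (meson mem_interior_cball)
  have bnd: "norm (T y) \<le> 2 * real n / e" if y: "norm y \<le> 1" for y
  proof (cases "T y = 0")
    case True
    then show ?thesis using e by simp
  next
    case False
    let ?z = "(e / norm (T y)) *\<^sub>R T y"
    have nz: "norm ?z = e" using False e by simp
    have "x0 + ?z \<in> K n" "x0 \<in> K n"
      using e nz by (auto simp: subset_iff dist_norm)
    then have "norm (ip (T y) (x0 + ?z)) \<le> real n" "norm (ip (T y) x0) \<le> real n"
      using y by (auto simp: K_def)
    moreover have "ip (T y) ?z = ip (T y) (x0 + ?z) - ip (T y) x0"
      by (simp add: ip_add_right)
    ultimately have "norm (ip (T y) ?z) \<le> 2 * real n"
      using norm_triangle_ineq4[of "ip (T y) (x0 + ?z)" "ip (T y) x0"] by simp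
    moreover have "norm (ip (T y) ?z) = e * norm (T y)"
      using e False by (simp add: ip_scaleR_right norm_ip_self power2_eq_square)
    ultimately show ?thesis using e by (simp add: field_simps)
  qed
  show ?thesis
  proof (rule bounded_linear_intro)
    show "norm (T x) \<le> norm x * (2 * real n / e)" for x
    proof (cases "x = 0")
      case True
      then show ?thesis using scale[of 0 0] by simp
    next
      case False
      have "norm (T (inverse (norm x) *\<^sub>R x)) \<le> 2 * real n / e"
        using False by (intro bnd) simp
      then show ?thesis using False by (simp add: scale field_simps)
    qed
  qed (fact add scale)+
qed

lemma proj_sphere_act:
  assumes "projection p" "x \<in> proj_sphere ip p"
  shows "act x p = x"
proof -
  have "ip (x - act x p) (x - act x p) = 0"
    using assms
    by (simp add: projection_def proj_sphere_def ip_diff_left ip_diff_right ip_act_left ip_act_right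
        mult.assoc)
  then show ?thesis using ip_definite by fastforce
qed

lemma ray_in_projective_space:
  assumes "projection p" "x \<in> proj_sphere ip p"
  shows "ray act x \<in> projective_space act ip"
proof -
  have "act x (ip x z) \<in> ray act x" for z
    by (simp add: ray_def)
  moreover have "z - act x (ip x z) \<in> ortho_compl ip (ray act x)" for z
  proof -
    have "p * ip x z = ip x z"
      using proj_sphere_act[OF assms] assms(1) by (metis ip_act_left projection_def)
    then show ?thesis
      using assms(2)
      by (auto simp: ortho_compl_def ray_def ip_act_left ip_diff_right ip_act_right proj_sphere_def)
  qed
  moreover have "z = act x (ip x z) + (z - act x (ip x z))" for z
    by simp
  ultimately have "orthocomplemented ip (ray act x)"
    unfolding orthocomplemented_def by blast
  then show ?thesis unfolding projective_space_def by blast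
qed

lemma topspace_projective_topology:
  "topspace (projective_topology act ip) = projective_space act ip"
proof
  show "topspace (projective_topology act ip) \<subseteq> projective_space act ip"
    by (metis openin_projective_topology openin_topspace)
  have "{x \<in> proj_sphere ip p. ray act x \<in> projective_space act ip} = proj_sphere ip p"
    if "projection p" for p
    using ray_in_projective_space[OF that] by blast
  then have "openin (projective_topology act ip) (projective_space act ip)"
    by (simp add: openin_projective_topology)
  then show "projective_space act ip \<subseteq> topspace (projective_topology act ip)"
    by (rule openin_subset)
qed

lemma theta_in_equivalent_projections:
  assumes "projection p" "x \<in> proj_sphere ip p"
  shows "theta act ip x x \<in> equivalent_projections act ip x"
proof -
  let ?P = "theta act ip x x"
  have "is_adjoint ip (blinfun_apply ?P) (blinfun_apply ?P)"
    unfolding is_adjoint_def by (simp add: ip_act_left ip_act_right star_ip)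
  moreover have "?P o\<^sub>L ?P = ?P"
  proof (rule blinfun_eqI)
    fix z
    have "blinfun_apply (?P o\<^sub>L ?P) z = act (act x p) (ip x z)"
      using assms(2) by (simp add: ip_act_right act_act proj_sphere_def)
    then show "blinfun_apply (?P o\<^sub>L ?P) z = blinfun_apply ?P z"
      by (simp add: proj_sphere_act[OF assms])
  qed
  ultimately show ?thesis
    using theta_adjointable[of x x]
    unfolding equivalent_projections_def mvn_equiv_def projection_op_def by blast
qed

end

end

theory Submission
  imports Defs
begin

text \<open>
  A ray \<open>[x]\<close> with \<open>x \<in> S\<^sub>p(X)\<close> is the range of the projection \<open>\<theta>\<^bsub>x,x\<^esub>\<close>, and a projection is
  determined by its range. The projections equivalent to \<open>\<theta>\<^bsub>x0,x0\<^esub>\<close> are the \<open>\<theta>\<^bsub>y,y\<^esub>\<close>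
  with \<open>y \<in> S\<^sub>p(X)\<close>: take \<open>y = V\<^sup>*x0\<close> where
  \<open>VV\<^sup>* = \<theta>\<^bsub>x0,x0\<^esub>\<close>. So taking ranges is a bijection from them onto the set \<open>Y\<close>
  of rays of points of \<open>S\<^sub>p(X)\<close>. Its inverse is continuous because \<open>x \<mapsto> \<theta>\<^bsub>x,x\<^esub>\<close> is, and the map
  itself is continuous because \<open>x \<mapsto> \<theta>\<^bsub>x,x\<^esub>\<close> has local sections. Finally, each sphere
  \<open>S\<^sub>q(X)\<close> is sent either into \<open>Y\<close> or into its complement, so \<open>Y\<close> is clopen in the projective
  space and contains the whole component of \<open>[x0]\<close>.
\<close>

section \<open>The involution and inverse square roots in a C*-algebra\<close>

lemma star_minus: "star (- x) = - star (x::'a::cstar_algebra)"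
  by (metis add.right_inverse add_cancel_right_right minus_unique star_add)

lemma star_diff: "star (x - y) = star x - star (y::'a::cstar_algebra)"
  using star_add[of x "- y"] by (simp add: star_minus)

lemma star_scaleR: "star (r *\<^sub>R x) = r *\<^sub>R star (x::'a::cstar_algebra)"
  by (metis complex_cnj_complex_of_real scaleC_of_real star_scaleC)

lemma bounded_linear_star: "bounded_linear (star :: 'a::cstar_algebra \<Rightarrow> 'a)"
  by (rule bounded_linear_intro[where K = 1]) (simp_all add: star_add star_scaleR)

lemma norm_projection_le_1:
  fixes p :: "'a::cstar_algebra"
  assumes "projection p"
  shows "norm p \<le> 1"
proof -
  have "norm p = (norm p)\<^sup>2"
    using assms cstar_identity[of p] by (simp add: projection_def)
  then show ?thesis
    by (metis dual_order.refl mult_cancel_left1 norm_zero power2_eq_square zero_le_one norm_eq_zero)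
qed

text \<open>
  With \<open>t = p + c\<close>, the equation \<open>t\<^sup>2 (p - h) = p\<close> reads \<open>c = (h + 2ch + c\<^sup>2h - c\<^sup>2) / 2\<close>,
  whose right-hand side is a contraction of a small ball in the commutant of \<open>h\<close>.
\<close>

lemma inverse_sqrt_near_projection:
  fixes p h :: "'a::cstar_algebra"
  assumes p: "projection p" and h: "star h = h" "p * h = h" and small: "norm h \<le> 1/8"
  obtains c where "star c = c" "norm c \<le> norm h" "(p + c) * (p - h) * (p + c) = p"
proof -
  define F where "F c = (1/2) *\<^sub>R (h + 2 *\<^sub>R (c * h) + c * c * h - c * c)" for c
  \<comment> \<open>The radius 1/4, together with the bound 1/8 on \<open>h\<close>, keeps
    \<open>F\<close> inside the ball and makes it contract by 1/2. The condition
    \<open>p * c = c\<close> lets \<open>p\<close> act as a unit on \<open>c\<close>, since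
    \<open>'a\<close> itself may have none.\<close>
  define C where "C = {c. norm c \<le> 1/4} \<inter> {c. star c = c} \<inter> {c. p * c = c} \<inter> {c. c * h = h * c}"
  note [continuous_intros] = bounded_linear.continuous_on[OF bounded_linear_star]
  have "closed C"
    unfolding C_def by (intro closed_Int closed_Collect_le closed_Collect_eq continuous_intros)
  then have C: "complete C"
    by (simp add: complete_eq_closed)
  have sq: "norm (c * c) \<le> norm c * (1/4)" if "norm c \<le> 1/4" for c :: 'a
    by (rule order_trans[OF norm_mult_ineq mult_left_mono[OF that]]) simp
  have F_norm: "norm (F c) \<le> norm h / 2 + norm c / 2" if c: "norm c \<le> 1/4" for c
  proof -
    have ch: "norm (c * h) \<le> norm c * (1/8)"
      by (rule order_trans[OF norm_mult_ineq mult_left_mono[OF small]]) simp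
    have "norm (c * c * h) \<le> norm (c * c) * (1/8)"
      by (rule order_trans[OF norm_mult_ineq mult_left_mono[OF small]]) simp
    with sq[OF c] have cch: "norm (c * c * h) \<le> norm c * (1/4) * (1/8)"
      by linarith
    have "norm (h + 2 *\<^sub>R (c * h) + c * c * h - c * c)
        \<le> norm h + 2 * norm (c * h) + norm (c * c * h) + norm (c * c)"
      by (intro order_trans[OF norm_triangle_ineq4] add_mono order_trans[OF norm_triangle_ineq]) auto
    also have "\<dots> \<le> norm h + norm c"
      using ch cch sq[OF c] norm_ge_zero[of c] by linarith
    finally show ?thesis
      by (simp add: F_def)
  qed
  have F_C: "F c \<in> C" if "c \<in> C" for c
  proof -
    have c: "norm c \<le> 1/4" "star c = c" "p * c = c" "c * h = h * c"
      using that by (auto simp: C_def)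
    \<comment> \<open>The commutation rule in the form that applies to products nested to the right
      by \<open>mult.assoc\<close>.\<close>
    have chz: "c * (h * z) = h * (c * z)" for z
      by (simp only: c(4) flip: mult.assoc)
    have "star (F c) = F c"
      by (simp add: F_def star_scaleR star_add star_diff star_mult h c chz mult.assoc)
    moreover have "p * F c = F c"
      using h(2) c(3) by (simp add: F_def distrib_left right_diff_distrib flip: mult.assoc)
    moreover have "F c * h = h * F c"
      by (simp add: F_def distrib_left distrib_right right_diff_distrib left_diff_distrib
          mult.assoc c(4) chz)
    moreover have "norm (F c) \<le> 1/4"
      using F_norm[OF c(1)] c(1) small by linarith
    ultimately show ?thesis
      by (simp add: C_def)
  qed
  have F_lip: "dist (F c) (F d) \<le> 1/2 * dist c d" if "c \<in> C" "d \<in> C" for c d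
  proof -
    have cd: "norm c \<le> 1/4" "norm d \<le> 1/4"
      using that by (auto simp: C_def)
    \<comment> \<open>This is \<open>c * c - d * d\<close>, written so that no commutativity of
      \<open>c\<close> and \<open>d\<close> is used.\<close>
    let ?e = "c * (c - d) + (c - d) * d"
    have "norm (c * (c - d)) \<le> 1/4 * norm (c - d)"
      by (rule order_trans[OF norm_mult_ineq mult_right_mono[OF cd(1)]]) simp
    moreover have "norm ((c - d) * d) \<le> norm (c - d) * (1/4)"
      by (rule order_trans[OF norm_mult_ineq mult_left_mono[OF cd(2)]]) simp
    ultimately have e: "norm ?e \<le> norm (c - d) / 2"
      using norm_triangle_ineq[of "c * (c - d)" "(c - d) * d"] by linarith
    have eh: "norm (?e * h) \<le> norm ?e * (1/8)"
      by (rule order_trans[OF norm_mult_ineq mult_left_mono[OF small]]) simp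
    have ch: "norm ((c - d) * h) \<le> norm (c - d) * (1/8)"
      by (rule order_trans[OF norm_mult_ineq mult_left_mono[OF small]]) simp
    have "F c - F d = (1/2) *\<^sub>R (2 *\<^sub>R ((c - d) * h) + ?e * h - ?e)"
      by (simp add: F_def algebra_simps)
    then have "norm (F c - F d) \<le> 1/2 * (2 * norm ((c - d) * h) + norm (?e * h) + norm ?e)"
      using norm_triangle_ineq4[of "2 *\<^sub>R ((c - d) * h) + ?e * h" ?e]
        norm_triangle_ineq[of "2 *\<^sub>R ((c - d) * h)" "?e * h"] by simp
    \<comment> \<open>The three terms contribute at most 1/4, 1/16 and 1/2 of \<open>n\<close>,
      which sum to less than \<open>n\<close>.\<close>
    moreover have "1/2 * (2 * u + v + w) \<le> 1/2 * n"
      if "u \<le> n * (1/8)" "v \<le> w * (1/8)" "w \<le> n / 2" "0 \<le> n" for u v w n :: real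
      using that by simp
    ultimately show ?thesis
      unfolding dist_norm using ch eh e norm_ge_zero order_trans by blast
  qed
  have "0 \<in> C"
    using star_diff[of "0::'a" 0] by (simp add: C_def)
  then have "\<exists>!c\<in>C. F c = c"
    using F_C F_lip by (intro Banach_fix[OF C, of "1/2" F]) auto
  then obtain c where cC: "c \<in> C" and fp: "F c = c"
    by blast
  have c: "norm c \<le> 1/4" "star c = c" "p * c = c" "c * h = h * c"
    using cC by (auto simp: C_def)
  have cp: "c * p = c" and hp: "h * p = h" and pp: "p * p = p"
    using c h p by (metis star_mult projection_def)+
  have hpz: "h * (p * z) = h * z" and cpz: "c * (p * z) = c * z" and chz: "c * (h * z) = h * (c * z)" for z
    by (simp_all only: hp cp c(4) flip: mult.assoc)
  \<comment> \<open>Multiplying out with \<open>p\<close> as a unit for \<open>c\<close> and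
    \<open>h\<close> leaves \<open>p\<close> plus twice \<open>c - F c\<close>, and \<open>c\<close>
    is a fixed point of \<open>F\<close>.\<close>
  have "(p + c) * (p - h) * (p + c) = p + (2 *\<^sub>R c - (h + 2 *\<^sub>R (c * h) + c * c * h - c * c))"
    by (simp add: distrib_left distrib_right right_diff_distrib left_diff_distrib mult.assoc
        pp hp cp h(2) c(3,4) hpz cpz chz scaleR_2)
  also have "\<dots> = p"
    using arg_cong[OF fp, of "\<lambda>z. 2 *\<^sub>R z"] by (simp add: F_def)
  finally have "(p + c) * (p - h) * (p + c) = p" .
  \<comment> \<open>At the fixed point, \<open>F_norm\<close> bounds \<open>norm c\<close> by half
    of \<open>norm h\<close> plus half of itself.\<close>
  moreover have "norm c \<le> norm h"
    using F_norm[OF c(1)] fp by simp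
  ultimately show ?thesis
    using c(2) that by blast
qed

section \<open>Theta operators and their ranges\<close>

context hilbert_module
begin

text \<open>Moving \<open>T\<close> across the inner product reduces \<open>A\<close>-linearity of
  \<open>T\<close> to that of \<open>ip\<close> in its second argument.\<close>

lemma adjoint_act:
  assumes "is_adjoint ip T S"
  shows "T (act x a) = act (T x) a"
proof (rule ip_eqI)
  have "ip (S y) z = ip y (T z)" for y z
    using assms by (metis is_adjoint_def star_ip)
  then show "ip y (T (act x a)) = ip y (act (T x) a)" for y
    by (metis ip_act_right)
qed

lemma act_scaleR_left: "act (r *\<^sub>R x) a = r *\<^sub>R act x a"
  by (metis act_scaleC_left scaleC_of_real)

text \<open>Bilinearity is over the reals, as \<open>theta\<close> is conjugate-linear in its second
  vector argument. It yields norm continuity of the diagonal map sending \<open>x\<close> to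
  \<open>theta act ip x x\<close>.\<close>

lemma bounded_bilinear_theta: "bounded_bilinear (theta act ip)"
proof
  show "\<exists>K. \<forall>x y. norm (theta act ip x y) \<le> norm x * norm y * K"
  proof (intro exI allI)
    fix x y
    show "norm (theta act ip x y) \<le> norm x * norm y * 4"
    proof (rule norm_blinfun_bound)
      fix z
      have "norm (act x (ip y z)) \<le> norm x * (4 * (norm y * norm z))"
        by (rule order_trans[OF norm_act_le mult_left_mono[OF norm_ip_le]]) simp
      then show "norm (theta act ip x y z) \<le> norm x * norm y * 4 * norm z"
        by (simp add: mult_ac)
    qed simp
  qed
qed (auto intro!: blinfun_eqI simp: blinfun.add_left blinfun.scaleR_left act_add_left ip_add_left
      act_add_right ip_scaleR_left act_scaleR_right act_scaleR_left)

lemma continuous_on_theta: "continuous_on UNIV (\<lambda>x. theta act ip x x)"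
  by (intro bounded_bilinear.continuous_on[OF bounded_bilinear_theta] continuous_intros)

lemma proj_sphere_ip:
  assumes "projection p" "x \<in> proj_sphere ip p"
  shows "p * ip x z = ip x z"
  using ip_act_left[of x p z] assms(1) by (simp add: proj_sphere_act[OF assms] projection_def)

lemma projection_op_theta:
  assumes "projection p" "x \<in> proj_sphere ip p"
  shows "projection_op ip (theta act ip x x)"
  using theta_in_equivalent_projections[OF assms] by (simp add: equivalent_projections_def)

text \<open>The operator \<open>theta act ip x x\<close> fixes every \<open>act x a\<close>, because
  \<open>ip x x = p\<close> and \<open>act x p = x\<close>.\<close>

lemma range_theta:
  assumes "projection p" "x \<in> proj_sphere ip p"
  shows "range (theta act ip x x) = ray act x"
proof -
  have "act x a = theta act ip x x (act x a)" for a
  proof -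
    have "theta act ip x x (act x a) = act (act x p) a"
      using assms(2) by (simp add: ip_act_right act_act proj_sphere_def)
    then show ?thesis
      by (simp add: proj_sphere_act[OF assms])
  qed
  then show ?thesis
    by (auto simp: ray_def)
qed

text \<open>Each projection is the identity on the range of the other, so \<open>QP = P\<close> and
  \<open>PQ = Q\<close>. Taking adjoints in the first equation gives \<open>P = PQ\<close>.\<close>

lemma projection_op_eqI:
  assumes P: "projection_op ip P" and Q: "projection_op ip Q" and "range P = range Q"
  shows "P = Q"
proof -
  have fix_range: "A (B z) = B z"
    if A: "projection_op ip A" and eq: "range A = range B" for A B :: "'x \<Rightarrow>\<^sub>L 'x" and z
  proof -
    have "B z \<in> range A"
      by (simp add: eq)
    then obtain w where w: "B z = A w"
      by blast
    have "A (A w) = (A o\<^sub>L A) w"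
      by simp
    also have "\<dots> = A w"
      using A by (simp add: projection_op_def)
    finally show ?thesis
      by (simp add: w)
  qed
  have sym: "ip (A u) v = ip u (A v)" if "projection_op ip A" for A u v
    using that by (simp add: projection_op_def is_adjoint_def)
  show ?thesis
  proof (intro blinfun_eqI ip_eqI)
    fix z y
    have "ip y (P z) = ip (Q (P y)) z"
      using fix_range[OF Q assms(3)[symmetric], of y] by (simp add: sym[OF P])
    also have "\<dots> = ip y (P (Q z))"
      by (simp only: sym[OF P] sym[OF Q])
    also have "\<dots> = ip y (Q z)"
      by (simp only: fix_range[OF P assms(3)])
    finally show "ip y (P z) = ip y (Q z)" .
  qed
qed

lemma ray_eq_iff_theta_eq:
  assumes "projection p" "x \<in> proj_sphere ip p" "projection q" "y \<in> proj_sphere ip q"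
  shows "ray act x = ray act y \<longleftrightarrow> theta act ip x x = theta act ip y y"
  unfolding range_theta[OF assms(1,2), symmetric] range_theta[OF assms(3,4), symmetric]
  using projection_op_eqI[OF projection_op_theta[OF assms(1,2)] projection_op_theta[OF assms(3,4)]]
  by (auto simp del: theta_apply)

section \<open>Murray-von Neumann equivalence and change of sphere\<close>

text \<open>If \<open>W = V*\<close> with \<open>WV = Q\<close> and
  \<open>VW = theta act ip x x\<close>, then \<open>theta act ip (W x) (W x)\<close> equals
  \<open>WVWV\<close>, that is \<open>QQ = Q\<close>. Conversely \<open>theta act ip x y\<close> and
  its adjoint \<open>theta act ip y x\<close> implement the equivalence for every \<open>y\<close>
  in the sphere.\<close>

lemma equivalent_projections_eq:
  assumes p: "projection p" and x: "x \<in> proj_sphere ip p"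
  shows "equivalent_projections act ip x = (\<lambda>y. theta act ip y y) ` proj_sphere ip p"
proof (intro equalityI subsetI)
  have adj: "is_adjoint ip (theta act ip u v) (theta act ip v u)" for u v
    by (simp add: is_adjoint_def ip_act_left ip_act_right star_ip)
  {
    fix Q assume "Q \<in> equivalent_projections act ip x"
    then obtain V W where VW: "is_adjoint ip (blinfun_apply V) (blinfun_apply W)"
      and Q: "W o\<^sub>L V = Q" and th: "V o\<^sub>L W = theta act ip x x" and QQ: "Q o\<^sub>L Q = Q"
      by (auto simp: equivalent_projections_def mvn_equiv_def projection_op_def)
    have WV: "is_adjoint ip (blinfun_apply W) (blinfun_apply V)"
      using VW by (metis is_adjoint_def star_ip)
    have VWx: "V (W u) = act x (ip x u)" for u
      using arg_cong[OF th, of "\<lambda>A. blinfun_apply A u"] by simp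
    have WVx: "W (V u) = Q u" for u
      using arg_cong[OF Q, of "\<lambda>A. blinfun_apply A u"] by simp
    have QQx: "Q (Q u) = Q u" for u
      using arg_cong[OF QQ, of "\<lambda>A. blinfun_apply A u"] by simp
    have "ip (W x) (W x) = ip x (V (W x))"
      using WV by (simp add: is_adjoint_def)
    then have "W x \<in> proj_sphere ip p"
      using x p by (simp add: VWx proj_sphere_def ip_act_right projection_def)
    moreover have "Q = theta act ip (W x) (W x)"
    proof (rule blinfun_eqI)
      fix z
      have "theta act ip (W x) (W x) z = W (act x (ip x (V z)))"
        using WV by (simp add: adjoint_act[OF WV] is_adjoint_def)
      also have "\<dots> = W (V (W (V z)))"
        by (simp add: VWx)
      also have "\<dots> = Q z"
        by (simp only: WVx QQx)
      finally show "Q z = theta act ip (W x) (W x) z" by simp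
    qed
    ultimately show "Q \<in> (\<lambda>y. theta act ip y y) ` proj_sphere ip p"
      by blast
  next
    fix Q assume "Q \<in> (\<lambda>y. theta act ip y y) ` proj_sphere ip p"
    then obtain y where y: "y \<in> proj_sphere ip p" and Q: "Q = theta act ip y y"
      by blast
    have comp: "theta act ip u v o\<^sub>L theta act ip v u = theta act ip u u"
      if "u \<in> proj_sphere ip p" "v \<in> proj_sphere ip p" for u v
    proof (rule blinfun_eqI)
      fix z
      have "(theta act ip u v o\<^sub>L theta act ip v u) z = act (act u p) (ip u z)"
        using that(2) by (simp add: ip_act_right act_act proj_sphere_def)
      then show "(theta act ip u v o\<^sub>L theta act ip v u) z = theta act ip u u z"
        by (simp add: proj_sphere_act[OF p that(1)])
    qed
    show "Q \<in> equivalent_projections act ip x"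
      using theta_adjointable adj comp[OF x y] comp[OF y x] projection_op_theta[OF p y]
      unfolding equivalent_projections_def mvn_equiv_def Q by blast
  }
qed

text \<open>A common ray makes \<open>v = ip x y\<close> a partial isometry of the algebra with
  \<open>v v* = q\<close> and \<open>v* v = p\<close>. Acting by \<open>v\<close> carries the sphere
  of \<open>q\<close> into that of \<open>p\<close>, and acting by \<open>v*\<close> undoes this, so
  rays are preserved.\<close>

lemma ray_in_sphere_rays:
  assumes p: "projection p" and y: "y \<in> proj_sphere ip p"
    and q: "projection q" and x: "x \<in> proj_sphere ip q" and eq: "ray act x = ray act y"
    and x': "x' \<in> proj_sphere ip q"
  shows "ray act x' \<in> ray act ` proj_sphere ip p"
proof -
  have th: "theta act ip x x = theta act ip y y"
    using ray_eq_iff_theta_eq[OF q x p y] eq by simp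
  have thz: "act x (ip x z) = act y (ip y z)" for z
    using arg_cong[OF th, of "\<lambda>A. blinfun_apply A z"] by simp
  let ?y = "act x' (ip x y)"
  have qxy: "q * ip x y = ip x y"
    by (rule proj_sphere_ip[OF q x])
  have "ip ?y ?y = ip y (act x (ip x y))"
    using x' qxy by (simp add: ip_act_left ip_act_right proj_sphere_def star_ip mult.assoc)
  also have "\<dots> = ip y (act y (ip y y))"
    by (simp only: thz)
  also have "\<dots> = p"
    using y p by (simp add: ip_act_right proj_sphere_def projection_def)
  finally have "?y \<in> proj_sphere ip p"
    by (simp add: proj_sphere_def)
  moreover have "ray act x' = ray act ?y"
  proof -
    have "act (act ?y (ip y x)) a = act x' a" for a
    proof -
      have "ip x y * ip y x = ip x (act y (ip y x))"
        by (simp add: ip_act_right)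
      also have "\<dots> = ip x (act x (ip x x))"
        by (simp only: thz)
      also have "\<dots> = q"
        using x q by (simp add: ip_act_right proj_sphere_def projection_def)
      finally show ?thesis
        by (simp add: act_act proj_sphere_act[OF q x'])
    qed
    then have "act x' a \<in> ray act ?y" for a
      by (metis ray_def act_act rangeI)
    then show ?thesis
      by (auto simp: ray_def act_act)
  qed
  ultimately show ?thesis
    by blast
qed

section \<open>Local sections of the theta map\<close>

text \<open>
  Local sections of \<open>x \<mapsto> \<theta>\<^bsub>x,x\<^esub>\<close>: push \<open>x\<close> into the range of \<open>Q\<close> and renormalise to get \<open>y\<close>;
  then \<open>Q - \<theta>\<^bsub>y,y\<^esub>\<close> is an idempotent of norm less than 1, so it vanishes.
\<close>

lemma projection_op_near_theta:
  assumes p: "projection p" and x: "x \<in> proj_sphere ip p" and "e > 0"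
  obtains d where "d > 0"
    "\<And>Q. projection_op ip Q \<Longrightarrow> dist Q (theta act ip x x) < d \<Longrightarrow>
      \<exists>y\<in>proj_sphere ip p. dist y x < e \<and> Q = theta act ip y y"
proof -
  have "isCont (\<lambda>x. theta act ip x x) x"
    using continuous_on_theta by (simp add: continuous_on_eq_continuous_at)
  then obtain e' where e': "e' > 0"
    and near: "\<And>y. dist y x < e' \<Longrightarrow> dist (theta act ip y y) (theta act ip x x) < 1/2"
    unfolding continuous_at_eps_delta by (meson half_gt_zero_iff zero_less_one)
  \<comment> \<open>The bound 1/32 ensures \<open>norm h \<le> 4 * d \<le> 1/8\<close>. The factor
    21 is 1 + 5 * 4: the distance from \<open>Q x\<close> to \<open>x\<close> is below
    \<open>d\<close>, and the correction by \<open>c\<close> costs at most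
    \<open>5 * norm c\<close>.\<close>
  define d where "d = min (1/32) (min e e' / 21)"
  have d: "d > 0" "d \<le> 1/32" "21 * d \<le> e" "21 * d \<le> e'"
    using \<open>e > 0\<close> \<open>e' > 0\<close> by (auto simp: d_def min_def field_simps)
  have ipxx: "ip x x = p"
    using x by (simp add: proj_sphere_def)
  have nx: "norm x \<le> 1"
    using norm_projection_le_1[OF p] by (simp add: norm_ip[of x] ipxx)
  have "\<exists>y\<in>proj_sphere ip p. dist y x < e \<and> Q = theta act ip y y"
    if Q: "projection_op ip Q" and dQ: "dist Q (theta act ip x x) < d" for Q
  proof -
    have sa: "ip (Q u) v = ip u (Q v)" for u v
      using Q by (simp add: projection_op_def is_adjoint_def)
    have QQ: "Q (Q u) = Q u" for u
    proof -
      have "Q o\<^sub>L Q = Q"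
        using Q by (simp add: projection_op_def)
      from arg_cong[OF this, of "\<lambda>A. blinfun_apply A u"] show ?thesis
        by simp
    qed
    have Qact: "Q (act u a) = act (Q u) a" for u a
      using Q adjoint_act projection_op_def by blast
    have "Q x - x = (Q - theta act ip x x) x"
      using proj_sphere_act[OF p x] by (simp add: blinfun.diff_left ipxx)
    then have "norm (Q x - x) \<le> norm (Q - theta act ip x x) * norm x"
      by (simp add: norm_blinfun)
    also have "\<dots> \<le> norm (Q - theta act ip x x) * 1"
      by (rule mult_left_mono[OF nx]) simp
    finally have Qx: "norm (Q x - x) < d"
      using dQ by (simp add: dist_norm)
    \<comment> \<open>A crude bound: 4 from \<open>norm_ip_le\<close> for the theta operator, and 1
      for its difference from \<open>Q\<close>.\<close>
    have nQ: "norm (Q u) \<le> 5 * norm u" for u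
    proof -
      have "norm (act x (ip x u)) \<le> 1 * (4 * (1 * norm u))"
        by (intro order_trans[OF norm_act_le] mult_mono order_trans[OF norm_ip_le] mult_left_mono nx)
           (use nx in auto)
      moreover have "norm ((Q - theta act ip x x) u) \<le> 1 * norm u"
        by (rule order_trans[OF norm_blinfun mult_right_mono]) (use dQ d in \<open>auto simp: dist_norm\<close>)
      moreover have "Q u = (Q - theta act ip x x) u + act x (ip x u)"
        by (simp add: blinfun.diff_left)
      ultimately show ?thesis
        using norm_triangle_ineq[of "(Q - theta act ip x x) u" "act x (ip x u)"] by simp
    qed
    \<comment> \<open>As \<open>Q\<close> is a projection, \<open>ip (Q x) (Q x) = p - h\<close>;
      thus \<open>h\<close> measures how far \<open>Q x\<close> is from the sphere, and acting by
      \<open>p + c\<close> normalises it.\<close>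
    define h where "h = ip x (x - Q x)"
    have "norm h \<le> 4 * (norm x * norm (x - Q x))"
      unfolding h_def by (rule norm_ip_le)
    also have "\<dots> \<le> 4 * (1 * norm (x - Q x))"
      by (intro mult_left_mono mult_right_mono nx) auto
    finally have nh: "norm h \<le> 4 * d"
      using Qx by (simp add: norm_minus_commute)
    have h_eq: "h = p - ip x (Q x)"
      by (simp add: h_def ip_diff_right ipxx)
    have "star h = h"
      by (simp add: h_def star_ip star_diff ip_diff_right sa)
    moreover have "p * h = h"
      unfolding h_def by (rule proj_sphere_ip[OF p x])
    moreover have "norm h \<le> 1/8"
      using nh d(2) by linarith
    ultimately obtain c
      where c: "star c = c" "norm c \<le> norm h" "(p + c) * (p - h) * (p + c) = p"
      by (rule inverse_sqrt_near_projection[OF p])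
    define y where "y = Q (act x (p + c))"
    have "ip y y = ip (act x (p + c)) (Q (act x (p + c)))"
      unfolding y_def by (simp add: sa QQ)
    also have "\<dots> = (p + c) * (p - h) * (p + c)"
      using p c(1) by (simp add: Qact ip_act_left ip_act_right star_add projection_def h_eq mult.assoc)
    finally have y: "y \<in> proj_sphere ip p"
      using c(3) by (simp add: proj_sphere_def)
    have yx_eq: "y - x = (Q x - x) + Q (act x c)"
      unfolding y_def by (simp add: act_add_right proj_sphere_act[OF p x] blinfun.add_right)
    have "norm (Q (act x c)) \<le> 5 * (1 * norm c)"
      by (intro order_trans[OF nQ] mult_left_mono order_trans[OF norm_act_le] mult_right_mono nx) auto
    then have yx: "dist y x < 21 * d"
      using norm_triangle_ineq[of "Q x - x" "Q (act x c)"] Qx nh c(2)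
      unfolding dist_norm yx_eq by linarith
    let ?R = "Q - theta act ip y y"
    have Qy: "Q y = y"
      by (simp add: y_def QQ)
    \<comment> \<open>Since \<open>Q\<close> fixes \<open>y\<close> and is self-adjoint, it absorbs
      \<open>theta act ip y y\<close> on both sides.\<close>
    have idem: "?R o\<^sub>L ?R = ?R"
    proof (rule blinfun_eqI)
      fix z
      have "act y (ip y (act y (ip y z))) = act y (ip y z)"
        using y by (simp add: ip_act_right proj_sphere_act[OF p] proj_sphere_def flip: act_act)
      moreover have "ip y (Q z) = ip y z"
        by (metis sa Qy)
      ultimately show "(?R o\<^sub>L ?R) z = ?R z"
        by (simp add: blinfun.diff_left blinfun.diff_right Qact Qy QQ ip_diff_right)
    qed
    have "dist (theta act ip y y) (theta act ip x x) < 1/2"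
      using near yx d by simp
    then have "norm ?R < 1"
      using dist_triangle2[of Q "theta act ip y y" "theta act ip x x"] dQ d by (simp add: dist_norm)
    \<comment> \<open>An idempotent has norm 0 or at least 1.\<close>
    moreover have "norm ?R \<le> norm ?R * norm ?R"
      using norm_blinfun_compose[of ?R ?R] idem by simp
    ultimately have "norm ?R = 0"
      using mult_less_cancel_right2[of "norm ?R" "norm ?R"] by (simp add: not_less)
    then show ?thesis
      using y yx d by force
  qed
  then show ?thesis
    using that d(1) by blast
qed

section \<open>The homeomorphism onto the rays of a sphere\<close>

text \<open>The map is injective by \<open>projection_op_eqI\<close> and onto by
  \<open>equivalent_projections_eq\<close>. Showing that it is open replaces continuity of the
  inverse.\<close>

lemma homeomorphic_map_range_projection:
  assumes p: "projection p" and x: "x \<in> proj_sphere ip p"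
  shows "homeomorphic_map (top_of_set (equivalent_projections act ip x))
     (subtopology (projective_topology act ip) (ray act ` proj_sphere ip p))
     (\<lambda>Q. range (blinfun_apply Q))"
proof -
  define E where "E = equivalent_projections act ip x"
  let ?T = "projective_topology act ip" and ?Y = "ray act ` proj_sphere ip p"
  let ?g = "\<lambda>Q. range (blinfun_apply Q)"
  have E: "E = (\<lambda>y. theta act ip y y) ` proj_sphere ip p"
    unfolding E_def by (rule equivalent_projections_eq[OF assms])
  have gE: "?g ` E = ?Y"
    using range_theta[OF p] by (force simp: E image_image)
  have Y: "?Y \<subseteq> projective_space act ip"
    using ray_in_projective_space[OF p] by blast
  have proj: "projection_op ip Q" if "Q \<in> E" for Q
    using that projection_op_theta[OF p] by (auto simp: E)
  have top: "topspace (subtopology ?T ?Y) = ?Y"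
    using Y by (auto simp: topspace_projective_topology)
  have gE_theta: "?g Q = ray act z \<longleftrightarrow> Q = theta act ip z z"
    if q: "projection q" and z: "z \<in> proj_sphere ip q" and "Q \<in> E" for q z Q
  proof
    assume "?g Q = ray act z"
    then have "?g Q = ?g (theta act ip z z)"
      by (simp only: range_theta[OF q z])
    then show "Q = theta act ip z z"
      by (rule projection_op_eqI[OF proj[OF \<open>Q \<in> E\<close>] projection_op_theta[OF q z]])
  qed (simp only: range_theta[OF q z])
  have inj: "inj_on ?g E"
    by (intro inj_onI projection_op_eqI proj)
  have cont: "continuous_map (top_of_set E) ?T ?g"
    unfolding continuous_map
  proof (intro conjI allI impI)
    show "?g ` topspace (top_of_set E) \<subseteq> topspace ?T"
      using gE top by auto
    fix U assume U: "openin ?T U"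
    show "openin (top_of_set E) {Q \<in> topspace (top_of_set E). ?g Q \<in> U}"
      unfolding openin_euclidean_subtopology_iff
    proof (intro conjI ballI)
      fix Q assume "Q \<in> {Q \<in> topspace (top_of_set E). ?g Q \<in> U}"
      then obtain y where y: "y \<in> proj_sphere ip p" and Q: "Q = theta act ip y y"
        and yU: "ray act y \<in> U"
        using range_theta[OF p] by (auto simp: E)
      have "openin (top_of_set (proj_sphere ip p)) {z \<in> proj_sphere ip p. ray act z \<in> U}"
        using U p by (simp add: openin_projective_topology)
      then obtain e where e: "e > 0"
        "\<And>z. z \<in> proj_sphere ip p \<Longrightarrow> dist z y < e \<Longrightarrow> ray act z \<in> U"
        using y yU unfolding openin_euclidean_subtopology_iff by blast
      \<comment> \<open>A projection close to \<open>Q\<close> lifts to a point of the sphere close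
        to \<open>y\<close>, where rays are already known to lie in \<open>U\<close>.\<close>
      obtain d where d: "d > 0" "\<And>Q. projection_op ip Q \<Longrightarrow> dist Q (theta act ip y y) < d \<Longrightarrow>
          \<exists>z\<in>proj_sphere ip p. dist z y < e \<and> Q = theta act ip z z"
        using projection_op_near_theta[OF p y e(1)] by blast
      have "?g Q' \<in> U" if "Q' \<in> E" "dist Q' Q < d" for Q'
        using d(2)[OF proj] that e(2) range_theta[OF p] unfolding Q by metis
      then show "\<exists>d>0. \<forall>Q'\<in>E. dist Q' Q < d \<longrightarrow> Q' \<in> {Q \<in> topspace (top_of_set E). ?g Q \<in> U}"
        using d(1) by auto
    qed auto
  qed
  have "open_map (top_of_set E) ?T ?g"
    unfolding open_map_def
  proof (intro allI impI)
    fix V assume "openin (top_of_set E) V"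
    then obtain V' where V': "open V'" and V: "V = E \<inter> V'"
      by (auto simp: openin_open)
    have VE: "V \<subseteq> E"
      using V by blast
    show "openin ?T (?g ` V)"
      unfolding openin_projective_topology
    proof (intro conjI allI impI)
      show "?g ` V \<subseteq> projective_space act ip"
        using image_mono[OF VE, of ?g] Y unfolding gE by (rule order_trans)
      fix q :: 'a assume q: "projection q"
      let ?S = "proj_sphere ip q"
      have pre: "ray act z \<in> ?g ` B \<longleftrightarrow> theta act ip z z \<in> B"
        if z: "z \<in> ?S" and B: "B \<subseteq> E" for z B
      proof
        assume "ray act z \<in> ?g ` B"
        then obtain Q where Q: "ray act z = ?g Q" "Q \<in> B"
          by (rule imageE)
        have "Q = theta act ip z z"
          by (rule gE_theta[OF q z subsetD[OF B Q(2)], THEN iffD1, OF Q(1)[symmetric]])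
        with Q(2) show "theta act ip z z \<in> B"
          by (simp only:)
      next
        assume "theta act ip z z \<in> B"
        then show "ray act z \<in> ?g ` B"
          unfolding range_theta[OF q z, symmetric] by (rule imageI)
      qed
      show "openin (top_of_set ?S) {z \<in> ?S. ray act z \<in> ?g ` V}"
      \<comment> \<open>Openness is tested on every sphere, also for \<open>q\<close> other than
        \<open>p\<close>. Once one ray of \<open>?S\<close> lies in \<open>?Y\<close>, all do, and
        the set is a preimage of \<open>V'\<close> under the continuous theta map; otherwise it is
        empty.\<close>
      proof (cases "\<exists>z\<in>?S. ray act z \<in> ?Y")
        case True
        then have "ray act z \<in> ?g ` E" if "z \<in> ?S" for z
          unfolding gE using ray_in_sphere_rays[OF p _ q _ _ that] by blast
        then have "theta act ip z z \<in> E" if "z \<in> ?S" for z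
          using pre[OF that subset_refl, THEN iffD1] that by blast
        then have "ray act z \<in> ?g ` V \<longleftrightarrow> theta act ip z z \<in> V'" if "z \<in> ?S" for z
          unfolding pre[OF that VE] using V that by blast
        then have "{z \<in> ?S. ray act z \<in> ?g ` V} = ?S \<inter> (\<lambda>z. theta act ip z z) -` V'"
          by blast
        moreover have "open ((\<lambda>z. theta act ip z z) -` V')"
          using open_vimage[OF V' continuous_on_theta] .
        ultimately show ?thesis
          by (simp add: openin_open_Int)
      next
        case False
        then have "{z \<in> ?S. ray act z \<in> ?g ` V} = {}"
          using image_mono[OF VE, of ?g] unfolding gE by blast
        then show ?thesis by (metis openin_empty)
      qed
    qed
  qed
  then have "open_map (top_of_set E) (subtopology ?T ?Y) ?g"
    using gE by (intro open_map_into_subtopology) auto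
  moreover have "continuous_map (top_of_set E) (subtopology ?T ?Y) ?g"
    using cont gE by (auto simp: continuous_map_in_subtopology)
  ultimately show ?thesis
    using inj gE top unfolding E_def[symmetric]
    by (intro bijective_open_imp_homeomorphic_map) auto
qed

text \<open>By \<open>ray_in_sphere_rays\<close> the preimage in each sphere is empty or the whole
  sphere, and the same holds for the complement.\<close>

lemma clopen_sphere_rays:
  assumes p: "projection p"
  shows "openin (projective_topology act ip) (ray act ` proj_sphere ip p)"
    and "closedin (projective_topology act ip) (ray act ` proj_sphere ip p)"
proof -
  let ?Y = "ray act ` proj_sphere ip p"
  have all_or_none: "{z \<in> proj_sphere ip q. ray act z \<in> ?Y} \<in> {{}, proj_sphere ip q}"
    if q: "projection q" for q
    using ray_in_sphere_rays[OF p _ q] by fastforce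
  have Y: "?Y \<subseteq> projective_space act ip"
    using ray_in_projective_space[OF p] by blast
  have op: "openin (top_of_set S) A" if "A \<in> {{}, S}" for A S :: "'x set"
    using that by auto
  show "openin (projective_topology act ip) ?Y"
    unfolding openin_projective_topology using Y op[OF all_or_none] by blast
  have "{z \<in> proj_sphere ip q. ray act z \<in> projective_space act ip - ?Y} \<in> {{}, proj_sphere ip q}"
    if q: "projection q" for q
    using all_or_none[OF q] ray_in_projective_space[OF q] by blast
  then show "closedin (projective_topology act ip) ?Y"
    unfolding closedin_def topspace_projective_topology openin_projective_topology
    using Y op by blast
qed

end

theorem theorem2p5:
  fixes act :: "'x::complex_banach \<Rightarrow> 'a::cstar_algebra \<Rightarrow> 'x"
    and ip :: "'x \<Rightarrow> 'x \<Rightarrow> 'a"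
    and p :: 'a and x0 :: 'x
  assumes "hilbert_module act ip" and "full ip"
    and "projection p" and "x0 \<in> proj_sphere ip p"
  shows "subtopology (projective_topology act ip)
           (connected_component_of_set (projective_topology act ip) (ray act x0))
         homeomorphic_space
         subtopology (top_of_set (equivalent_projections act ip x0))
           (connected_component_of_set (top_of_set (equivalent_projections act ip x0))
             (theta act ip x0 x0))"
proof -
  interpret hilbert_module act ip by fact
  let ?T = "projective_topology act ip" and ?Y = "ray act ` proj_sphere ip p"
  let ?E = "top_of_set (equivalent_projections act ip x0)" and ?P = "theta act ip x0 x0"
  let ?g = "\<lambda>Q. range (blinfun_apply Q)"
  have hom: "homeomorphic_map ?E (subtopology ?T ?Y) ?g"
    by (rule homeomorphic_map_range_projection) fact+
  have x0: "ray act x0 \<in> ?Y" "?g ?P = ray act x0"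
    using assms(4) range_theta[OF assms(3,4)] by auto
  let ?C = "connected_component_of_set ?T (ray act x0)"
  have "ray act x0 \<in> topspace ?T"
    using assms(3,4) ray_in_projective_space by (simp add: topspace_projective_topology)
  then have "ray act x0 \<in> ?C"
    by (simp add: connected_component_of_refl)
  \<comment> \<open>A connected set meeting a clopen set lies inside it. Hence the component of
    \<open>ray act x0\<close> is the same in \<open>?Y\<close> as in the whole space.\<close>
  then have CY: "?C \<subseteq> ?Y"
    using connectedin_clopen_cases[OF connectedin_connected_component_of
        clopen_sphere_rays(2,1)[OF assms(3)]] x0(1) by (meson disjnt_iff)
  have "connected_component_of_set (subtopology ?T ?Y) (?g ?P) =
      ?g ` connected_component_of_set ?E ?P"
    using theta_in_equivalent_projections[OF assms(3,4)]
    by (intro homeomorphic_map_connected_component_of[OF hom]) auto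
  moreover have "connected_component_of (subtopology ?T ?Y) (ray act x0)
      = connected_component_of ?T (ray act x0)"
    using CY by (simp add: connected_component_of_subtopology_eq)
  ultimately have C: "?C = ?g ` connected_component_of_set ?E ?P"
    unfolding x0(2) by simp
  have "homeomorphic_map (subtopology ?E (connected_component_of_set ?E ?P))
      (subtopology (subtopology ?T ?Y) ?C) ?g"
  proof (rule homeomorphic_map_subtopologies[OF hom])
    have "topspace ?E \<inter> connected_component_of_set ?E ?P = connected_component_of_set ?E ?P"
      using connected_component_of_subset_topspace[of ?E ?P] by blast
    moreover have "topspace (subtopology ?T ?Y) \<inter> ?C = ?C"
      using CY connected_component_of_subset_topspace[of ?T "ray act x0"] by auto
    ultimately show "?g ` (topspace ?E \<inter> connected_component_of_set ?E ?P)
        = topspace (subtopology ?T ?Y) \<inter> ?C"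
      using C by simp
  qed
  moreover have "subtopology (subtopology ?T ?Y) ?C = subtopology ?T ?C"
    using CY by (simp add: subtopology_subtopology inf.absorb2)
  ultimately show ?thesis
    using homeomorphic_map_imp_homeomorphic_space homeomorphic_space_sym by metis
qed

end
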